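(* Fix $k\in\mathbb{N}$ and $\alpha\ge1$. Suppose that for every $n\in\mathbb{N}$ there is a deterministic (possibly adaptive) $\alpha$-approximation algorithm for the average distance in all finite metric spaces which makes $m(n)$ distance queries on inputs of size $n$, where $m(n)=o(n^{(k+1)/k})$ as $n\to\infty$. Then $\alpha\ge 2(k+1)$.
   Context: Let $[n]=\{1,\ldots,n\}$ and $\binom{[n]}{2}$ the set of unordered pairs of distinct elements of $[n]$. A deterministic $\alpha$-approximation algorithm for the average distance (in all metric spaces) making $m$ queries on inputs of size $n$ consists of functions $\mathsf{Pair}_i:(\binom{[n]}{2}\times[0,\infty))^{i-1}\to\binom{[n]}{2}$ for $i=1,\ldots,m$ ($\mathsf{Pair}_1$ being a fixed pair) and $\mathsf{Estimate}:(\binom{[n]}{2}\times[0,\infty))^m\to[0,\infty)$, such that for every metric space $(\mathcal{M},d)$ and $x_1,\ldots,x_n\in\mathcal{M}$, defining pairs $\{a_i,b_i\}=\mathsf{Pair}_i\big((\{a_1,b_1\},d(x_{a_1},x_{b_1})),\ldots,(\{a_{i-1},b_{i-1}\},d(x_{a_{i-1}},x_{b_{i-1}}))\big)$ inductively, the output $E=\mathsf{Estimate}\big((\{a_j,b_j\},d(x_{a_j},x_{b_j}))_{j=1}^m\big)$ satisfies $A\le E\le\alpha A$, where $A=\frac{1}{n^2}\sum_{(i,j)\in[n]^2}d(x_i,x_j)$ (with $E=0$ required when $A=0$). *)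

theory Defs
  imports
    "HOL-Analysis.Abstract_Metric_Spaces"
    "HOL-Library.FuncSet"
    "HOL-Library.Landau_Symbols"
    "HOL-Library.Ramsey"
begin

type_synonym transcript = "(nat set \<times> real) list"

definition transcripts :: "nat \<Rightarrow> nat \<Rightarrow> transcript set" where
  "transcripts n i = {h. length h = i \<and> set h \<subseteq> nsets {1..n} 2 \<times> {0..}}"

text \<open>For \<open>e = {a, b}\<close> this is \<open>d (x a) (x b)\<close>; the order in which the two
  elements are taken is irrelevant because \<open>d\<close> is symmetric.\<close>
definition pair_dist :: "('a \<Rightarrow> 'a \<Rightarrow> real) \<Rightarrow> (nat \<Rightarrow> 'a) \<Rightarrow> nat set \<Rightarrow> real" where
  "pair_dist d x e = d (x (Min e)) (x (Max e))"

text \<open>\<open>query i\<close> is the paper's function \<open>Pair\<close> with subscript \<open>i\<close>: it chooses the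
  \<open>i\<close>-th query (counted from 1) from the transcript of the first \<open>i - 1\<close> queries and
  answers. \<open>D\<close> is the distance oracle.\<close>
primrec run :: "(nat \<Rightarrow> transcript \<Rightarrow> nat set) \<Rightarrow> (nat set \<Rightarrow> real) \<Rightarrow> nat \<Rightarrow> transcript" where
  "run query D 0 = []"
| "run query D (Suc i) =
     (let h = run query D i; e = query (Suc i) h in h @ [(e, D e)])"

definition avg_dist :: "nat \<Rightarrow> ('a \<Rightarrow> 'a \<Rightarrow> real) \<Rightarrow> (nat \<Rightarrow> 'a) \<Rightarrow> real" where
  "avg_dist n d x = (1 / (real n)\<^sup>2) * (\<Sum>(i, j)\<in>{1..n} \<times> {1..n}. d (x i) (x j))"

text \<open>If the average distance is 0, the two inequalities force the output to be 0.\<close>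
definition approximates ::
  "nat \<Rightarrow> nat \<Rightarrow> real \<Rightarrow> (nat \<Rightarrow> transcript \<Rightarrow> nat set) \<Rightarrow> (transcript \<Rightarrow> real) \<Rightarrow>
   ('a \<Rightarrow> 'a \<Rightarrow> real) \<Rightarrow> (nat \<Rightarrow> 'a) \<Rightarrow> bool" where
  "approximates n m \<alpha> query estimate d x \<longleftrightarrow>
     (let A = avg_dist n d x; E = estimate (run query (pair_dist d x) m)
      in A \<le> E \<and> E \<le> \<alpha> * A)"

text \<open>A formula cannot quantify over types, so the metric spaces range over all finite
  metric spaces whose points are natural numbers. Every finite metric space is isometric to
  one of these, and lemma \<open>approx_algorithm_all_metric_spaces\<close> derives correctness
  on metric spaces over any type.\<close>
definition approx_algorithm ::
  "nat \<Rightarrow> nat \<Rightarrow> real \<Rightarrow> (nat \<Rightarrow> transcript \<Rightarrow> nat set) \<Rightarrow> (transcript \<Rightarrow> real) \<Rightarrow> bool" where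
  "approx_algorithm n m \<alpha> query estimate \<longleftrightarrow>
     (\<forall>i\<in>{1..m}. query i \<in> transcripts n (i - 1) \<rightarrow> nsets {1..n} 2) \<and>
     estimate \<in> transcripts n m \<rightarrow> {0..} \<and>
     (\<forall>(M :: nat set) d x.
        Metric_space M d \<and> finite M \<and> x \<in> {1..n} \<rightarrow> M \<longrightarrow>
        approximates n m \<alpha> query estimate d x)"

lemma nsets_2_Min_Max:
  assumes "e \<in> nsets {1..n} 2"
  shows "Min e \<in> {1..n}" "Max e \<in> {1..n}"
proof -
  have "finite e" "e \<noteq> {}" "e \<subseteq> {1..n}"
    using assms by (auto simp: nsets_def)
  then show "Min e \<in> {1..n}" "Max e \<in> {1..n}"
    using Min_in Max_in by blast+
qed

lemma run_in_transcripts: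
  assumes "\<forall>i\<in>{1..m}. query i \<in> transcripts n (i - 1) \<rightarrow> nsets {1..n} 2"
    and "\<And>e. e \<in> nsets {1..n} 2 \<Longrightarrow> 0 \<le> D e"
    and "i \<le> m"
  shows "run query D i \<in> transcripts n i"
  using \<open>i \<le> m\<close>
proof (induction i)
  case 0
  then show ?case by (simp add: transcripts_def)
next
  case (Suc i)
  then have h: "run query D i \<in> transcripts n i" by simp
  have "query (Suc i) \<in> transcripts n (Suc i - 1) \<rightarrow> nsets {1..n} 2"
    using Suc.prems by (intro bspec[OF assms(1)]) simp
  then have "query (Suc i) (run query D i) \<in> nsets {1..n} 2"
    using h by auto
  then show ?case
    using h assms(2) by (auto simp: transcripts_def Let_def)
qed

lemma run_cong:
  assumes "\<forall>i\<in>{1..m}. query i \<in> transcripts n (i - 1) \<rightarrow> nsets {1..n} 2"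
    and "\<And>e. e \<in> nsets {1..n} 2 \<Longrightarrow> 0 \<le> D e"
    and "\<And>e. e \<in> nsets {1..n} 2 \<Longrightarrow> D' e = D e"
    and "i \<le> m"
  shows "run query D' i = run query D i"
  using \<open>i \<le> m\<close>
proof (induction i)
  case (Suc i)
  have "run query D i \<in> transcripts n i"
    using run_in_transcripts[OF assms(1,2)] Suc.prems by simp
  moreover have "query (Suc i) \<in> transcripts n (Suc i - 1) \<rightarrow> nsets {1..n} 2"
    using Suc.prems by (intro bspec[OF assms(1)]) simp
  ultimately have "query (Suc i) (run query D i) \<in> nsets {1..n} 2"
    by auto
  then show ?case
    using Suc assms(3) by (simp add: Let_def)
qed simp

lemma approx_algorithm_all_metric_spaces:
  fixes M :: "'a set"
  assumes alg: "approx_algorithm n m \<alpha> query estimate"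
    and "Metric_space M d" and x: "x \<in> {1..n} \<rightarrow> M"
  shows "approximates n m \<alpha> query estimate d x"
proof -
  interpret Metric_space M d by fact
  obtain f :: "'a \<Rightarrow> nat" where f: "inj_on f (x ` {1..n})"
    using finite_imp_inj_to_nat_seg[of "x ` {1..n}"] by auto
  define g where "g = inv_into (x ` {1..n}) f"
  define N where "N = f ` x ` {1..n}"
  define d' where "d' u v = d (g u) (g v)" for u v
  define x' where "x' i = f (x i)" for i
  have g: "g (x' i) = x i" if "i \<in> {1..n}" for i
    using that f unfolding g_def x'_def by (intro inv_into_f_f) auto
  have gM: "g u \<in> M" if "u \<in> N" for u
    using that g x unfolding N_def x'_def by (auto simp: Pi_iff)
  have inj: "g u = g v \<longleftrightarrow> u = v" if "u \<in> N" "v \<in> N" for u v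
    using that g unfolding N_def x'_def by auto
  have "Metric_space N d'"
    using gM inj by unfold_locales (auto simp: d'_def commute triangle)
  moreover have "finite N" "x' \<in> {1..n} \<rightarrow> N"
    by (auto simp: N_def x'_def)
  ultimately have *: "approximates n m \<alpha> query estimate d' x'"
    using alg unfolding approx_algorithm_def by blast
  have "avg_dist n d' x' = avg_dist n d x"
    unfolding avg_dist_def d'_def using g by (auto intro!: sum.cong)
  moreover have "run query (pair_dist d' x') m = run query (pair_dist d x) m"
  proof (rule run_cong)
    show "\<forall>i\<in>{1..m}. query i \<in> transcripts n (i - 1) \<rightarrow> nsets {1..n} 2"
      using alg unfolding approx_algorithm_def by blast
    show "pair_dist d' x' e = pair_dist d x e" if "e \<in> nsets {1..n} 2" for e
      using nsets_2_Min_Max[OF that] g by (simp add: pair_dist_def d'_def)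
  qed (simp_all add: pair_dist_def)
  ultimately show ?thesis
    using * by (simp add: approximates_def)
qed

end

(* An adversary answers the queries. The level of a point of current degree c is
   1 + #{j in {1..k}. q^j <= c} with q of order delta * n^(1/k), and a new query {x, y} gets the
   sum of the two levels, corrected as little as possible so that the answers stay metric. In the
   end the adversary may reveal the largest metric with these answers (a shortest path metric
   cut off at 2k + 2) or a small one.

   Largest metric: a query at x made while x has level l <= k is one of at most q^l such queries.
   Split the length of a path into the levels of the initial and of the terminal points of its
   edges. On a path of length at most 2k + 1 one of the two sums is at most k, so up to reversal
   it is one of O(q^k) = O(delta^k n) paths from its starting point: almost all distances are
   2k + 2.

   Small metric: all but o(n) points x (the core) have final level 1 and distance at least
   level(y) from every other point y. Gluing the core together at mutual distance 1 changes no
   answer, and almost all distances become 1. *)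
theory Submission
  imports Defs "HOL-Real_Asymp.Real_Asymp"
begin

section \<open>Walks in a labelled graph and the number of their endpoints\<close>

lemma card_insert_le_Suc: "card (insert x A) \<le> Suc (card A)"
  by (cases "finite A") (simp_all add: card_insert_if)

text \<open>\<open>s\<close> and \<open>t\<close> sum the labels at the initial and at the terminal points of the edges.\<close>
inductive walk :: "(nat \<Rightarrow> nat \<Rightarrow> nat) \<Rightarrow> nat \<Rightarrow> nat \<Rightarrow> nat \<Rightarrow> nat \<Rightarrow> bool"
  for lab where
  refl: "walk lab u u 0 0"
| step: "walk lab u v s t \<Longrightarrow> lab v w > 0 \<Longrightarrow> walk lab u w (s + lab v w) (t + lab w v)"

lemma walk_trans:
  assumes "walk lab v w s' t'" "walk lab u v s t"
  shows "walk lab u w (s + s') (t + t')"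
  using assms
proof (induction rule: walk.induct)
  case (step v x s' t' w)
  then show ?case using walk.step[of lab u x "s + s'" "t + t'" w] by (simp add: add.assoc)
qed auto

lemma walk_edge: "lab v w > 0 \<Longrightarrow> walk lab v w (lab v w) (lab w v)"
  using walk.step[OF walk.refl, of lab v w] by simp

lemma walk_sym:
  assumes "walk lab u v s t" and sym: "\<And>x y. lab x y > 0 \<Longrightarrow> lab y x > 0"
  shows "walk lab v u t s"
  using assms(1)
proof (induction rule: walk.induct)
  case (step u v s t w)
  then show ?case
    using walk_trans[OF step.IH walk_edge[of lab w v]] sym by (simp add: add.commute)
qed (rule walk.refl)

lemma walk_mono:
  assumes "walk lab u v s t" and "\<And>x y. lab x y > 0 \<Longrightarrow> lab' x y = lab x y"
    and sym: "\<And>x y. lab x y > 0 \<Longrightarrow> lab y x > 0"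
  shows "walk lab' u v s t"
  using assms(1)
proof (induction rule: walk.induct)
  case (step u v s t w)
  have "lab' v w = lab v w" "lab' w v = lab w v" using assms(2) sym step.hyps(2) by auto
  then show ?case using walk.step[OF step.IH, of w] step.hyps(2) by simp
qed (rule walk.refl)

text \<open>The last edge has a positive label at its terminal point, by symmetry. This unit of
  \<open>t\<close> is what later saves a factor \<open>q\<close> in the count of points outside the
  core.\<close>

lemma walk_nontrivial:
  assumes "walk lab u v s t" "u \<noteq> v" and sym: "\<And>x y. lab x y > 0 \<Longrightarrow> lab y x > 0"
  shows "t > 0"
  using assms(1,2) by (cases rule: walk.cases) (auto simp: sym)

text \<open>Split off the last edge. If its initial label is \<open>a\<close>, its initial point is
  one of at most \<open>(2 * q) ^ (s - a)\<close> points by induction, and each of these has at most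
  \<open>q ^ a\<close> such edges. The geometric sum of \<open>2 ^ (s - a)\<close> over
  \<open>a\<close> stays below \<open>2 ^ s\<close>. Finiteness is carried along because
  \<open>card\<close> of an infinite set is 0.\<close>

lemma card_walk_endpoints:
  assumes "\<And>v j. j \<in> {1..k} \<Longrightarrow> finite {w. lab v w = j} \<and> card {w. lab v w = j} \<le> q ^ j"
    and "s \<le> k"
  shows "finite {v. \<exists>t. walk lab u v s t} \<and> card {v. \<exists>t. walk lab u v s t} \<le> (2 * q) ^ s"
  using \<open>s \<le> k\<close>
proof (induction s rule: less_induct)
  case (less s)
  let ?R = "\<lambda>s. {v. \<exists>t. walk lab u v s t}"
  show ?case
  proof (cases "s = 0")
    case True
    have "?R 0 \<subseteq> {u}" by (auto elim: walk.cases)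
    then have "finite (?R 0)" "card (?R 0) \<le> 1"
      using card_mono[of "{u}" "?R 0"] finite_subset[of "?R 0" "{u}"] by auto
    then show ?thesis using True by simp
  next
    case False
    have step: "finite (?R (s - a)) \<and> card (?R (s - a)) \<le> (2 * q) ^ (s - a)" if "a \<in> {1..s}" for a
      using that less.IH[of "s - a"] less.prems False by auto
    have nb: "finite {w. lab v w = a} \<and> card {w. lab v w = a} \<le> q ^ a" if "a \<in> {1..s}" for v a
      using that assms(1)[of a v] less.prems by auto
    let ?U = "\<Union>a\<in>{1..s}. \<Union>v\<in>?R (s - a). {w. lab v w = a}"
    have sub: "?R s \<subseteq> ?U"
    proof
      fix w assume "w \<in> ?R s"
      then obtain t where "walk lab u w s t" by auto
      then show "w \<in> ?U"
      proof (cases rule: walk.cases)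
        case (step v s' t')
        then show ?thesis
          by (intro UN_I[of "lab v w"] UN_I[of v]) auto
      qed (use False in auto)
    qed
    have fin: "finite ?U" using step nb by blast
    have "card ?U \<le> (\<Sum>a\<in>{1..s}. card (\<Union>v\<in>?R (s - a). {w. lab v w = a}))"
      by (rule card_UN_le) simp
    also have "\<dots> \<le> (\<Sum>a\<in>{1..s}. 2 ^ (s - a) * q ^ s)"
    proof (rule sum_mono)
      fix a assume a: "a \<in> {1..s}"
      have "card (\<Union>v\<in>?R (s - a). {w. lab v w = a}) \<le> (\<Sum>v\<in>?R (s - a). card {w. lab v w = a})"
        using step[OF a] by (intro card_UN_le) simp
      also have "\<dots> \<le> (\<Sum>v\<in>?R (s - a). q ^ a)"
        using nb[OF a] by (intro sum_mono) simp
      also have "\<dots> \<le> (2 * q) ^ (s - a) * q ^ a" using step[OF a] by simp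
      also have "\<dots> = 2 ^ (s - a) * q ^ s"
        using a by (simp add: power_mult_distrib flip: power_add)
      finally show "card (\<Union>v\<in>?R (s - a). {w. lab v w = a}) \<le> 2 ^ (s - a) * q ^ s" .
    qed
    also have "\<dots> = (\<Sum>a\<in>{1..s}. 2 ^ (s - a)) * q ^ s" by (simp add: sum_distrib_right)
    also have "(\<Sum>a\<in>{1..s}. 2 ^ (s - a)) = (\<Sum>a<s. 2 ^ a :: nat)"
      by (rule sum.reindex_bij_witness[of _ "\<lambda>a. s - a" "\<lambda>a. s - a"]) auto
    also have "\<dots> \<le> 2 ^ s" by (induction s) auto
    finally have "card ?U \<le> (2 * q) ^ s" by (simp add: power_mult_distrib)
    then show ?thesis
      using card_mono[OF fin sub] finite_subset[OF sub fin] by linarith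
  qed
qed

section \<open>Runs against oracles that agree on the queries\<close>

text \<open>Each query depends only on earlier answers, so agreement on the pairs actually asked
  suffices; \<open>run_cong\<close> demands it for all pairs.\<close>

lemma run_eqI:
  "(\<And>e. e \<in> fst ` set (run query D i) \<Longrightarrow> D' e = D e) \<Longrightarrow> run query D' i = run query D i"
proof (induction i)
  case (Suc i)
  then have "run query D' i = run query D i" by (simp add: Let_def)
  then show ?case using Suc.prems by (simp add: Let_def)
qed simp

lemma pair_dist_doubleton:
  assumes "\<And>u v. d u v = d v u"
  shows "pair_dist d (\<lambda>x. x) {a, b} = d a (b::nat)"
  using assms by (cases "a \<le> b") (auto simp: pair_dist_def min_def max_def)

section \<open>Levels as a function of the degree\<close>

locale adversary =
  fixes n k q :: nat
  assumes q: "q \<ge> 1"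
begin

definition lev :: "nat \<Rightarrow> nat" where
  "lev c = 1 + card {j \<in> {1..k}. q ^ j \<le> c}"

lemma lev_bounds: "1 \<le> lev c" "lev c \<le> k + 1"
proof -
  have "card {j \<in> {1..k}. q ^ j \<le> c} \<le> card {1..k}" by (intro card_mono) auto
  then show "lev c \<le> k + 1" by (simp add: lev_def)
qed (simp add: lev_def)

lemma lev_mono: "c \<le> c' \<Longrightarrow> lev c \<le> lev c'"
  unfolding lev_def by (intro add_left_mono card_mono) auto

text \<open>The powers \<open>q ^ j\<close> are monotone in \<open>j\<close>, so the thresholds
  reached by \<open>c\<close> form an initial segment of \<open>{1..k}\<close>, and the next one is
  not reached. Strictness leaves room for the query being asked.\<close>

lemma less_power_lev:
  assumes "lev c \<le> k"
  shows "c < q ^ lev c"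
proof (rule ccontr)
  assume "\<not> c < q ^ lev c"
  then have "q ^ j \<le> c" if "j \<le> lev c" for j
    using power_increasing[OF that q] by linarith
  then have "{1..lev c} \<subseteq> {j \<in> {1..k}. q ^ j \<le> c}" using assms by auto
  from card_mono[OF _ this] show False by (simp add: lev_def)
qed

text \<open>The last threshold reached has index \<open>lev c - 1\<close>. This turns a high level
  into a lower bound on the degree.\<close>

lemma power_lev_le:
  assumes "lev c \<ge> 2"
  shows "q ^ (lev c - 1) \<le> c"
proof (rule ccontr)
  assume *: "\<not> q ^ (lev c - 1) \<le> c"
  have "{j \<in> {1..k}. q ^ j \<le> c} \<subseteq> {1..<lev c - 1}"
  proof safe
    fix j assume j: "j \<in> {1..k}" "q ^ j \<le> c"
    have "j < lev c - 1"
    proof (rule ccontr)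
      assume "\<not> j < lev c - 1"
      then have "q ^ (lev c - 1) \<le> q ^ j" using q by (intro power_increasing) auto
      then show False using * j by simp
    qed
    then show "j \<in> {1..<lev c - 1}" using j by simp
  qed
  from card_mono[OF _ this] show False using assms by (simp add: lev_def)
qed

section \<open>The invariant of the adversary and its preservation by a query\<close>

definition deg :: "(nat \<Rightarrow> nat \<Rightarrow> nat) \<Rightarrow> nat \<Rightarrow> nat" where
  "deg lab x = card {y. lab x y > 0}"

text \<open>\<open>d\<close> is the largest metric bounded by \<open>2 * k + 2\<close> with the answers given so far, and
  \<open>lab x y\<close> is the level of \<open>x\<close> at the time when \<open>{x, y}\<close> was queried, and 0 if it has
  not been queried. The pair \<open>(a, b)\<close> in \<open>root\<close> is a query whose answer was chosen
  freely and forces the answer for \<open>(x, y)\<close> to be at least \<open>d x y\<close>.\<close>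
definition state :: "nat \<Rightarrow> (nat \<Rightarrow> nat \<Rightarrow> nat) \<Rightarrow> (nat \<Rightarrow> nat \<Rightarrow> nat) \<Rightarrow> bool" where
  "state i d lab \<longleftrightarrow>
     (\<forall>u. d u u = 0) \<and> (\<forall>u v. d u v = d v u) \<and> (\<forall>u v w. d u w \<le> d u v + d v w) \<and>
     (\<forall>u v. u \<noteq> v \<longrightarrow> 2 \<le> d u v) \<and> (\<forall>u v. d u v \<le> 2 * k + 2) \<and>
     (\<forall>x y. lab x y > 0 \<longrightarrow> lab y x > 0 \<and> x \<in> {1..n} \<and> y \<in> {1..n} \<and> x \<noteq> y) \<and>
     card {(x, y). lab x y > 0} \<le> 2 * i \<and>
     (\<forall>x. \<forall>j\<in>{1..k}. card {y. lab x y = j} \<le> q ^ j) \<and>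
     (\<forall>x y. lab x y > 0 \<longrightarrow> (\<exists>a b. lab a b > 0 \<and> d x y + d a x + d b y \<le> d a b \<and>
        d a b \<le> lev (deg lab a) + lev (deg lab b))) \<and>
     (\<forall>u v. d u v \<ge> 2 * k + 2 \<or> (\<exists>s t. walk lab u v s t \<and> s + t \<le> d u v))"

lemma stateD:
  assumes "state i d lab"
  shows d_refl: "d u u = 0" and d_comm: "d u v = d v u" and d_tri: "d u w \<le> d u v + d v w"
    and d_ge2: "u \<noteq> v \<Longrightarrow> 2 \<le> d u v" and d_le: "d u v \<le> 2 * k + 2"
    and lab_sym: "lab x y > 0 \<Longrightarrow> lab y x > 0"
    and lab_in: "lab x y > 0 \<Longrightarrow> x \<in> {1..n}" "lab x y > 0 \<Longrightarrow> y \<in> {1..n}"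
    and lab_neq: "lab x y > 0 \<Longrightarrow> x \<noteq> y"
    and card_lab: "card {(x, y). lab x y > 0} \<le> 2 * i"
    and card_lab_eq: "j \<in> {1..k} \<Longrightarrow> card {y. lab x y = j} \<le> q ^ j"
    and root: "lab x y > 0 \<Longrightarrow> \<exists>a b. lab a b > 0 \<and> d x y + d a x + d b y \<le> d a b \<and>
        d a b \<le> lev (deg lab a) + lev (deg lab b)"
    and walks: "d u v \<ge> 2 * k + 2 \<or> (\<exists>s t. walk lab u v s t \<and> s + t \<le> d u v)"
  using assms unfolding state_def by blast+

lemma state_init: "state 0 (\<lambda>u v. if u = v then 0 else 2 * k + 2) (\<lambda>_ _. 0)"
  unfolding state_def using walk.refl by auto

lemma finite_lab:
  assumes "state i d lab"
  shows "finite {y. lab x y > 0}" "j > 0 \<Longrightarrow> finite {y. lab x y = j}"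
  using lab_in(2)[OF assms] by (auto intro: finite_subset[of _ "{1..n}"])

lemma finite_lab_pairs:
  assumes "state i d lab"
  shows "finite {(x, y). lab x y > 0}"
  by (rule finite_subset[of _ "{1..n} \<times> {1..n}"]) (use lab_in[OF assms] in auto)

text \<open>A repeated query keeps its answer. Otherwise an edge of length \<open>a\<close> is added
  between \<open>x\<close> and \<open>y\<close>, and \<open>d'\<close> is the shortest path metric
  that results. The condition \<open>ok\<close> prevents the new edge from short-cutting an earlier
  answer.\<close>

lemma state_step:
  assumes st: "state i d lab" and xy: "x \<in> {1..n}" "y \<in> {1..n}" "x \<noteq> y"
  shows "\<exists>d' lab'. state (Suc i) d' lab' \<and> lab' x y > 0 \<and>
           (\<forall>u v. lab u v > 0 \<longrightarrow> lab' u v > 0 \<and> d' u v = d u v)"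
proof (cases "lab x y > 0")
  case True
  have "state (Suc i) d lab" using st unfolding state_def by auto
  with True show ?thesis by blast
next
  case False
  then have lab0: "lab x y = 0" "lab y x = 0" using lab_sym[OF st, of y x] by auto
  note R = d_refl[OF st] and C = d_comm[OF st] and T = d_tri[OF st]
  define lx where "lx = lev (deg lab x)"
  define ly where "ly = lev (deg lab y)"
  \<comment> \<open>The answer is \<open>a\<close>. It exceeds the sum of the levels only if an earlier answer would
    otherwise be short-cut, and then it inherits the root of that earlier query.\<close>
  define ok where "ok a \<longleftrightarrow> min (d x y) (lx + ly) \<le> a \<and>
    (\<forall>p r. lab p r > 0 \<longrightarrow> d p r \<le> d p x + a + d y r)" for a
  define a where "a = (LEAST a. ok a)"
  have okd: "ok (d x y)"
    unfolding ok_def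
  proof (intro conjI allI impI)
    fix p r
    show "d p r \<le> d p x + d x y + d y r" using T[of p r x] T[of x r y] by linarith
  qed simp
  have oka: "ok a" unfolding a_def using okd by (rule LeastI)
  have ale: "a \<le> d x y" unfolding a_def using okd by (rule Least_le)
  have a2: "a \<ge> 2"
  proof -
    have "min (d x y) (lx + ly) \<le> a" using oka by (simp add: ok_def)
    then show ?thesis
      using d_ge2[OF st xy(3)] lev_bounds(1)[of "deg lab x"] lev_bounds(1)[of "deg lab y"]
      unfolding lx_def ly_def by linarith
  qed
  have keep1: "d p r \<le> d p x + a + d y r" if "lab p r > 0" for p r
    using oka that unfolding ok_def by blast
  have keep2: "d p r \<le> d p y + a + d x r" if "lab p r > 0" for p r
    using keep1[OF lab_sym[OF st that]] C[of p r] C[of p y] C[of x r] by simp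
  define d' where "d' u v = min (d u v) (min (d u x + a + d y v) (d u y + a + d x v))" for u v
  \<comment> \<open>The labels freeze \<open>lx\<close> and \<open>ly\<close>, the levels before the
    new query is counted, whereas the levels in the root condition keep growing with the
    degrees.\<close>
  define lab' where "lab' u v = (if u = x \<and> v = y then lx else if u = y \<and> v = x then ly else lab u v)" for u v
  have lpos: "lx > 0" "ly > 0" using lev_bounds(1) by (auto simp: lx_def ly_def Suc_le_eq)
  have d'le: "d' u v \<le> d u v" for u v by (simp add: d'_def)
  have keep: "d' p r = d p r" if "lab p r > 0" for p r
    using keep1[OF that] keep2[OF that] by (simp add: d'_def)
  have C': "d' u v = d' v u" for u v
    using C[of u v] C[of u x] C[of u y] C[of v x] C[of v y] by (simp add: d'_def)
  have T': "d' u w \<le> d' u v + d' v w" for u v w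
  proof -
    have le: "d' u w \<le> d u w" "d' u w \<le> d u x + a + d y w" "d' u w \<le> d u y + a + d x w"
      by (auto simp: d'_def)
    have cases: "d' u v = d u v \<or> d' u v = d u x + a + d y v \<or> d' u v = d u y + a + d x v" for u v
      by (auto simp: d'_def min_def)
    from cases[of u v] show ?thesis
    proof (elim disjE)
      assume uv: "d' u v = d u v"
      from cases[of v w] show ?thesis
      proof (elim disjE)
        assume "d' v w = d v w"
        then show ?thesis using uv le(1) T[of u w v] by linarith
      next
        assume "d' v w = d v x + a + d y w"
        then show ?thesis using uv le(2) T[of u x v] by linarith
      next
        assume "d' v w = d v y + a + d x w"
        then show ?thesis using uv le(3) T[of u y v] by linarith
      qed
    next
      assume uv: "d' u v = d u x + a + d y v"
      from cases[of v w] show ?thesis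
      proof (elim disjE)
        assume "d' v w = d v w"
        then show ?thesis using uv le(2) T[of y w v] by linarith
      next
        assume "d' v w = d v x + a + d y w"
        then show ?thesis using uv le(2) by linarith
      next
        assume "d' v w = d v y + a + d x w"
        then show ?thesis using uv le(1) T[of u w x] by linarith
      qed
    next
      assume uv: "d' u v = d u y + a + d x v"
      from cases[of v w] show ?thesis
      proof (elim disjE)
        assume "d' v w = d v w"
        then show ?thesis using uv le(3) T[of x w v] by linarith
      next
        assume "d' v w = d v x + a + d y w"
        then show ?thesis using uv le(1) T[of u w y] by linarith
      next
        assume "d' v w = d v y + a + d x w"
        then show ?thesis using uv le(3) by linarith
      qed
    qed
  qed
  have d'xy: "d' x y = a" using R ale C[of x y] by (simp add: d'_def)
  have d'yx: "d' y x = a" using d'xy C' by simp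
  have lab'pos: "lab' u v > 0" and lab'eq: "lab' u v = lab u v" if "lab u v > 0" for u v
    using that lab0 lpos by (auto simp: lab'_def)
  have sym': "lab' v u > 0" if "lab' u v > 0" for u v
    using that lpos lab_sym[OF st] by (auto simp: lab'_def split: if_splits)
  have in': "u \<in> {1..n} \<and> v \<in> {1..n} \<and> u \<noteq> v" if "lab' u v > 0" for u v
    using that xy lab_in[OF st, of u v] lab_neq[OF st, of u v]
    by (auto simp: lab'_def split: if_splits)
  have fin': "finite {w. lab' u w > 0}" for u
    by (rule finite_subset[of _ "{1..n}"]) (use in' in auto)
  have deg': "lev (deg lab u) \<le> lev (deg lab' u)" for u
    unfolding deg_def using fin' lab'pos by (intro lev_mono card_mono) auto
  have card': "card {(u, v). lab' u v > 0} \<le> 2 * Suc i"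
  proof -
    have "{(u, v). lab' u v > 0} \<subseteq> insert (x, y) (insert (y, x) {(u, v). lab u v > 0})"
      by (auto simp: lab'_def split: if_splits)
    then have "card {(u, v). lab' u v > 0} \<le> card (insert (x, y) (insert (y, x) {(u, v). lab u v > 0}))"
      using finite_lab_pairs[OF st] by (intro card_mono) auto
    also have "\<dots> \<le> Suc (card (insert (y, x) {(u, v). lab u v > 0}))"
      by (rule card_insert_le_Suc)
    also have "\<dots> \<le> Suc (Suc (card {(u, v). lab u v > 0}))"
      by (subst Suc_le_mono) (rule card_insert_le_Suc)
    finally show ?thesis using card_lab[OF st] by simp
  qed
  \<comment> \<open>Before the query the degree is strictly below \<open>q ^ j\<close>, so one more
    neighbour \<open>z\<close> still fits.\<close>
  have new: "card {w. w = z \<or> lab u w = j} \<le> q ^ j"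
    if "j = lev (deg lab u)" "j \<in> {1..k}" for u z j
  proof -
    have "card {w. lab u w = j} \<le> deg lab u"
      unfolding deg_def using finite_lab(1)[OF st] that by (intro card_mono) auto
    moreover have "{w. w = z \<or> lab u w = j} = insert z {w. lab u w = j}" by auto
    moreover have "card (insert z {w. lab u w = j}) \<le> Suc (card {w. lab u w = j})"
      by (rule card_insert_le_Suc)
    ultimately show ?thesis using less_power_lev[of "deg lab u"] that by auto
  qed
  have count': "card {v. lab' u v = j} \<le> q ^ j" if j: "j \<in> {1..k}" for u j
  proof -
    have fin: "finite {v. lab u v = j}" using finite_lab(2)[OF st] j by auto
    consider "u = x" "j = lx" | "u = y" "j = ly" | "\<not> (u = x \<and> j = lx)" "\<not> (u = y \<and> j = ly)" by blast
    then show ?thesis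
    proof cases
      case 1
      have "card {v. lab' u v = j} \<le> card {v. v = y \<or> lab u v = j}"
        using fin 1 xy by (intro card_mono) (auto simp: lab'_def split: if_splits)
      then show ?thesis using new[of j u y] 1 j by (simp add: lx_def)
    next
      case 2
      have "card {v. lab' u v = j} \<le> card {v. v = x \<or> lab u v = j}"
        using fin 2 xy by (intro card_mono) (auto simp: lab'_def split: if_splits)
      then show ?thesis using new[of j u x] 2 j by (simp add: ly_def)
    next
      case 3
      have "card {v. lab' u v = j} \<le> card {v. lab u v = j}"
        using fin 3 xy by (intro card_mono) (auto simp: lab'_def split: if_splits)
      then show ?thesis using card_lab_eq[OF st j, of u] by simp
    qed
  qed
  \<comment> \<open>Passing to \<open>d'\<close> can only shrink the left side; the answer for the
    queried pair \<open>A\<close>, \<open>B\<close> is kept, and levels only grow. With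
    \<open>c\<close>, \<open>p\<close>, \<open>r\<close> arbitrary, this serves the old pairs as
    well as the new one.\<close>
  have old_root: "\<exists>A B. lab' A B > 0 \<and> c + d' A p + d' B r \<le> d' A B \<and>
      d' A B \<le> lev (deg lab' A) + lev (deg lab' B)"
    if "lab A B > 0" "c + d A p + d B r \<le> d A B" "d A B \<le> lev (deg lab A) + lev (deg lab B)"
    for A B c p r
  proof (intro exI conjI)
    show "lab' A B > 0" using lab'pos that by blast
    show "c + d' A p + d' B r \<le> d' A B"
      using that keep d'le[of A p] d'le[of B r] by simp
    show "d' A B \<le> lev (deg lab' A) + lev (deg lab' B)"
      using that keep deg'[of A] deg'[of B] by simp
  qed
  have new_root: "\<exists>A B. lab' A B > 0 \<and> a + d' A x + d' B y \<le> d' A B \<and>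
      d' A B \<le> lev (deg lab' A) + lev (deg lab' B)"
  proof (cases "a \<le> lx + ly")
    case True
    have "lab' x y > 0" using lpos by (simp add: lab'_def)
    moreover have "d' x x = 0" "d' y y = 0" using R by (auto simp: d'_def)
    ultimately show ?thesis
      using True deg'[of x] deg'[of y] d'xy unfolding lx_def ly_def
      by (intro exI[of _ x] exI[of _ y]) auto
  next
    case False
    \<comment> \<open>By minimality some queried pair \<open>p\<close>, \<open>r\<close> satisfies
      \<open>d p r \<ge> d p x + a + d y r\<close>, so it is tight through the new edge. The
      triangle inequality at \<open>p\<close> and \<open>r\<close> then transfers its root to
      \<open>x\<close>, \<open>y\<close>. Since \<open>a \<ge> 2\<close>, the subtraction is
      exact.\<close>
    have "\<not> ok (a - 1)" using a2 not_less_Least[of "a - 1" ok] by (simp add: a_def)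
    moreover have "min (d x y) (lx + ly) \<le> a - 1" using False by auto
    ultimately obtain p r where pr: "lab p r > 0" "d p r > d p x + (a - 1) + d y r"
      unfolding ok_def by (auto simp: not_le)
    from root[OF st pr(1)] obtain A B where AB: "lab A B > 0" "d p r + d A p + d B r \<le> d A B"
      "d A B \<le> lev (deg lab A) + lev (deg lab B)" by blast
    have "a + d A x + d B y \<le> d A B"
      using AB(2) pr(2) T[of A x p] T[of B y r] C[of r y] a2 by linarith
    then show ?thesis using old_root AB by blast
  qed
  have root': "\<exists>A B. lab' A B > 0 \<and> d' u v + d' A u + d' B v \<le> d' A B \<and>
      d' A B \<le> lev (deg lab' A) + lev (deg lab' B)" if uv: "lab' u v > 0" for u v
  proof -
    consider "u = x" "v = y" | "u = y" "v = x" | "lab u v > 0"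
      using uv by (auto simp: lab'_def split: if_splits)
    then show ?thesis
    proof cases
      case 1
      then show ?thesis using new_root d'xy by simp
    next
      case 2
      from new_root obtain A B where "lab' A B > 0" "a + d' A x + d' B y \<le> d' A B"
        "d' A B \<le> lev (deg lab' A) + lev (deg lab' B)" by blast
      then show ?thesis
        using sym' d'yx 2 C'[of A B] by (intro exI[of _ B] exI[of _ A]) auto
    next
      case 3
      obtain A B where "lab A B > 0" "d u v + d A u + d B v \<le> d A B"
        "d A B \<le> lev (deg lab A) + lev (deg lab B)" using root[OF st 3] by blast
      then show ?thesis unfolding keep[OF 3] by (rule old_root)
    qed
  qed
  have mono: "walk lab' u v s t" if "walk lab u v s t" for u v s t
    using walk_mono[OF that, of lab'] lab'eq lab_sym[OF st] by blast
  \<comment> \<open>\<open>X\<close>, \<open>Y\<close> cover both directions of the new edge. A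
    total below \<open>2 * k + 2\<close> forces both outer distances to be realised by walks, and
    the new edge costs \<open>lx + ly\<close>.\<close>
  have detour: "\<exists>s t. walk lab' u v s t \<and> s + t \<le> d u X + a + d Y v"
    if "(X = x \<and> Y = y) \<or> (X = y \<and> Y = x)" "d u X + a + d Y v < 2 * k + 2" "lx + ly \<le> a"
    for u v X Y
  proof -
    from walks[OF st, of u X] that obtain s1 t1 where 1: "walk lab u X s1 t1" "s1 + t1 \<le> d u X"
      by auto
    from walks[OF st, of Y v] that obtain s2 t2 where 2: "walk lab Y v s2 t2" "s2 + t2 \<le> d Y v"
      by auto
    have "lab' X Y > 0" and l: "lab' X Y + lab' Y X = lx + ly"
      using that(1) lpos xy by (auto simp: lab'_def)
    then have "walk lab' X Y (lab' X Y) (lab' Y X)" by (intro walk_edge)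
    from walk_trans[OF mono[OF 2(1)] walk_trans[OF this mono[OF 1(1)]]]
    have "walk lab' u v (s1 + lab' X Y + s2) (t1 + lab' Y X + t2)" .
    then show ?thesis using l 1 2 that(3)
      by (intro exI[of _ "s1 + lab' X Y + s2"] exI[of _ "t1 + lab' Y X + t2"]) simp
  qed
  have walks': "d' u v \<ge> 2 * k + 2 \<or> (\<exists>s t. walk lab' u v s t \<and> s + t \<le> d' u v)" for u v
  proof (cases "d' u v = d u v")
    case True
    show ?thesis unfolding True using walks[OF st, of u v] mono by blast
  next
    case False
    \<comment> \<open>With \<open>a = d x y\<close> the new edge would shorten nothing. Once
      \<open>a < d x y\<close>, the minimum in \<open>ok\<close> must be \<open>lx + ly\<close>, as
      \<open>detour\<close> requires.\<close>
    have "a < d x y"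
    proof (rule ccontr)
      assume "\<not> a < d x y"
      then have "a = d x y" using ale by simp
      then have "d' u v = d u v"
        using T[of u v x] T[of x v y] T[of u v y] T[of y v x] C[of x y] by (simp add: d'_def)
      with False show False by simp
    qed
    then have la: "lx + ly \<le> a" using oka by (auto simp: ok_def)
    have "d' u v = d u x + a + d y v \<or> d' u v = d u y + a + d x v"
      using False by (auto simp: d'_def min_def split: if_splits)
    then show ?thesis
    proof (elim disjE)
      assume eq: "d' u v = d u x + a + d y v"
      show ?thesis unfolding eq using detour[of x y u v, OF _ _ la] by (cases "d u x + a + d y v < 2 * k + 2") auto
    next
      assume eq: "d' u v = d u y + a + d x v"
      show ?thesis unfolding eq using detour[of y x u v, OF _ _ la] by (cases "d u y + a + d x v < 2 * k + 2") auto
    qed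
  qed
  have ge2': "d' u v \<ge> 2" if "u \<noteq> v" for u v
    using d_ge2[OF st that] a2 by (simp add: d'_def)
  have le': "d' u v \<le> 2 * k + 2" for u v using d'le d_le[OF st] order_trans by blast
  have refl': "d' u u = 0" for u using R[of u] by (simp add: d'_def)
  have st': "state (Suc i) d' lab'"
    unfolding state_def
    by (intro conjI allI impI ballI;
        (rule refl' C' T' le' card' walks' | rule ge2' count' root' sym', assumption | use in' in blast))
  have "lab' x y > 0" using lpos by (simp add: lab'_def)
  then show ?thesis
    using st' lab'pos keep by (intro exI[of _ d'] exI[of _ lab']) simp
qed

section \<open>Counting near pairs and points outside the core\<close>

text \<open>Points are lost from the core in two ways: few points have degree at least \<open>q\<close>,
  and around a point of level \<open>l \<ge> 3\<close>, hence of degree at least \<open>q ^ (l - 1)\<close>, the ball of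
  radius \<open>l - 1\<close> has only \<open>O(q ^ (l - 2))\<close> points, because each edge spends at least 1 on the
  level of its terminal point.\<close>
definition core :: "(nat \<Rightarrow> nat \<Rightarrow> nat) \<Rightarrow> (nat \<Rightarrow> nat \<Rightarrow> nat) \<Rightarrow> nat set" where
  "core d lab = {u \<in> {1..n}. lev (deg lab u) = 1 \<and>
     (\<forall>x\<in>{1..n}. x \<noteq> u \<longrightarrow> lev (deg lab x) \<le> d x u)}"

lemma sum_deg:
  assumes "state i d lab"
  shows "(\<Sum>x\<in>{1..n}. deg lab x) \<le> 2 * i"
proof -
  have "{(x, y). lab x y > 0} = (SIGMA x:{1..n}. {y. lab x y > 0})"
    using lab_in[OF assms] by auto
  then have "card {(x, y). lab x y > 0} = (\<Sum>x\<in>{1..n}. deg lab x)"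
    using finite_lab(1)[OF assms] by (simp add: deg_def)
  then show ?thesis using card_lab[OF assms] by simp
qed

lemma card_walk:
  assumes st: "state i d lab" and "s \<le> k"
  shows "finite {v. \<exists>t. walk lab u v s t}" "card {v. \<exists>t. walk lab u v s t} \<le> (2 * q) ^ s"
  using card_walk_endpoints[of k lab q s u] finite_lab(2)[OF st] card_lab_eq[OF st] assms(2) by auto

lemma card_walk_le:
  assumes st: "state i d lab" and "s \<le> k"
  shows "finite {v. \<exists>s'\<le>s. \<exists>t. walk lab u v s' t}"
    "card {v. \<exists>s'\<le>s. \<exists>t. walk lab u v s' t} \<le> (s + 1) * (2 * q) ^ s"
proof -
  have eq: "{v. \<exists>s'\<le>s. \<exists>t. walk lab u v s' t} = (\<Union>s'\<in>{..s}. {v. \<exists>t. walk lab u v s' t})" by auto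
  have fin: "finite {v. \<exists>t. walk lab u v s' t}" and card: "card {v. \<exists>t. walk lab u v s' t} \<le> (2 * q) ^ s'"
    if "s' \<le> s" for s'
    using card_walk[OF st, of s' u] that assms(2) by auto
  show "finite {v. \<exists>s'\<le>s. \<exists>t. walk lab u v s' t}" unfolding eq using fin by auto
  have "card (\<Union>s'\<in>{..s}. {v. \<exists>t. walk lab u v s' t}) \<le> (\<Sum>s'\<in>{..s}. card {v. \<exists>t. walk lab u v s' t})"
    by (rule card_UN_le) simp
  also have "\<dots> \<le> (\<Sum>s'\<in>{..s}. (2 * q) ^ s)"
  proof (rule sum_mono)
    fix s' assume "s' \<in> {..s}"
    then have "(2 * q) ^ s' \<le> (2 * q) ^ s" using q by (intro power_increasing) auto
    then show "card {v. \<exists>t. walk lab u v s' t} \<le> (2 * q) ^ s"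
      using card[of s'] \<open>s' \<in> {..s}\<close> by simp
  qed
  finally show "card {v. \<exists>s'\<le>s. \<exists>t. walk lab u v s' t} \<le> (s + 1) * (2 * q) ^ s"
    unfolding eq by simp
qed

text \<open>A walk with \<open>s + t \<le> 2 * k + 1\<close> has \<open>s \<le> k\<close> or
  \<open>t \<le> k\<close>. The second kind consists of reversals of the first, hence the factor
  2.\<close>

lemma card_near:
  assumes st: "state i d lab"
  shows "card {(u, v) \<in> {1..n} \<times> {1..n}. d u v < 2 * k + 2} \<le> 2 * (n * ((k + 1) * (2 * q) ^ k))"
proof -
  let ?W = "SIGMA u:{1..n}. {v. \<exists>s\<le>k. \<exists>t. walk lab u v s t}"
  have fin: "finite ?W" using card_walk_le(1)[OF st order_refl] by (intro finite_SigmaI) auto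
  have "card ?W = (\<Sum>u\<in>{1..n}. card {v. \<exists>s\<le>k. \<exists>t. walk lab u v s t})"
    using card_walk_le(1)[OF st order_refl] by (intro card_SigmaI) auto
  also have "\<dots> \<le> (\<Sum>u\<in>{1..n}. (k + 1) * (2 * q) ^ k)"
    by (intro sum_mono card_walk_le(2)[OF st order_refl])
  finally have W: "card ?W \<le> n * ((k + 1) * (2 * q) ^ k)" by simp
  have "{(u, v) \<in> {1..n} \<times> {1..n}. d u v < 2 * k + 2} \<subseteq> ?W \<union> prod.swap ` ?W"
  proof (rule subrelI)
    fix u v assume uv: "(u, v) \<in> {(u, v) \<in> {1..n} \<times> {1..n}. d u v < 2 * k + 2}"
    then obtain s t where st': "walk lab u v s t" "s + t \<le> d u v"
      using walks[OF st, of u v] by auto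
    consider "s \<le> k" | "t \<le> k" using st'(2) uv by force
    then show "(u, v) \<in> ?W \<union> prod.swap ` ?W"
    proof cases
      case 1
      then show ?thesis using uv st' by auto
    next
      case 2
      have "walk lab v u t s" using walk_sym[OF st'(1)] lab_sym[OF st] by blast
      then have "(v, u) \<in> ?W" using 2 uv by auto
      then show ?thesis by (intro UnI2 image_eqI[of _ _ "(v, u)"]) auto
    qed
  qed
  then have "card {(u, v) \<in> {1..n} \<times> {1..n}. d u v < 2 * k + 2} \<le> card (?W \<union> prod.swap ` ?W)"
    using fin by (intro card_mono) auto
  also have "\<dots> \<le> card ?W + card (prod.swap ` ?W)" by (rule card_Un_le)
  also have "card (prod.swap ` ?W) \<le> card ?W" using fin by (rule card_image_le)
  finally show ?thesis using W by linarith
qed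

text \<open>Every loss is charged to the degree of a point of \<open>H\<close>. The factor
  \<open>q\<close> on the left lifts the ball size \<open>q ^ (l - 2)\<close> to
  \<open>q ^ (l - 1)\<close>, which is at most the degree, and the degrees sum to at most
  \<open>2 * i\<close>.\<close>

lemma card_not_core:
  assumes st: "state i d lab"
  shows "q * card ({1..n} - core d lab) \<le> (1 + (k + 1) * 2 ^ k) * (2 * i)"
proof -
  let ?L = "\<lambda>x. lev (deg lab x)"
  define H where "H = {x \<in> {1..n}. ?L x \<ge> 2}"
  define R where "R x = {u. \<exists>s\<le>?L x - 2. \<exists>t. walk lab x u s t}" for x
  have Hle: "q ^ (?L x - 1) \<le> deg lab x" if "x \<in> H" for x
    using that power_lev_le unfolding H_def by blast
  have finH: "finite H" by (simp add: H_def)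
  have k: "?L x - 2 \<le> k" for x using lev_bounds(2)[of "deg lab x"] by simp
  have finR: "finite (R x)" for x unfolding R_def using card_walk_le(1)[OF st k] by blast
  have sumH: "(\<Sum>x\<in>H. deg lab x) \<le> 2 * i"
  proof -
    have "(\<Sum>x\<in>H. deg lab x) \<le> (\<Sum>x\<in>{1..n}. deg lab x)"
      by (intro sum_mono2) (auto simp: H_def)
    then show ?thesis using sum_deg[OF st] by simp
  qed
  have sub: "{1..n} - core d lab \<subseteq> H \<union> (\<Union>x\<in>H. R x)"
  proof
    fix u assume u: "u \<in> {1..n} - core d lab"
    show "u \<in> H \<union> (\<Union>x\<in>H. R x)"
    proof (cases "?L u = 1")
      case False
      then have "u \<in> H" using u lev_bounds(1)[of "deg lab u"] by (auto simp: H_def)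
      then show ?thesis by simp
    next
      case True
      then obtain x where x: "x \<in> {1..n}" "x \<noteq> u" "d x u < ?L x"
        using u by (auto simp: core_def not_le)
      then have "d x u < 2 * k + 2" using lev_bounds(2)[of "deg lab x"] by linarith
      then obtain s t where w: "walk lab x u s t" "s + t \<le> d x u"
        using walks[OF st, of x u] by auto
      \<comment> \<open>The distance is at most the level minus 1, and \<open>t\<close> takes at
        least 1 of it, so \<open>s\<close> is at most the level minus 2.\<close>
      have "t > 0" using walk_nontrivial[OF w(1) x(2)] lab_sym[OF st] by blast
      then have "s \<le> ?L x - 2" "?L x \<ge> 2" using w(2) x(3) by auto
      then have "x \<in> H" "u \<in> R x" using x(1) w(1) by (auto simp: H_def R_def)
      then show ?thesis by blast
    qed
  qed
  have cR: "q * card (R x) \<le> (k + 1) * 2 ^ k * deg lab x" if x: "x \<in> H" for x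
  proof -
    have L: "?L x \<ge> 2" using x by (simp add: H_def)
    have "card (R x) \<le> (?L x - 2 + 1) * (2 * q) ^ (?L x - 2)"
      unfolding R_def by (rule card_walk_le(2)[OF st k])
    also have "\<dots> = (?L x - 2 + 1) * 2 ^ (?L x - 2) * q ^ (?L x - 2)"
      by (simp only: power_mult_distrib mult.assoc)
    also have "\<dots> \<le> (k + 1) * 2 ^ k * q ^ (?L x - 2)"
      using k[of x] by (intro mult_right_mono mult_mono power_increasing) auto
    finally have "q * card (R x) \<le> q * ((k + 1) * 2 ^ k * q ^ (?L x - 2))" by (rule mult_left_mono) simp
    also have "\<dots> = (k + 1) * 2 ^ k * q ^ Suc (?L x - 2)" by simp
    also have "Suc (?L x - 2) = ?L x - 1" using L by simp
    also have "(k + 1) * 2 ^ k * q ^ (?L x - 1) \<le> (k + 1) * 2 ^ k * deg lab x"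
      using Hle[OF x] by (intro mult_left_mono) auto
    finally show ?thesis .
  qed
  have "card ({1..n} - core d lab) \<le> card (H \<union> (\<Union>x\<in>H. R x))"
    using finH finR by (intro card_mono[OF _ sub]) auto
  also have "\<dots> \<le> card H + card (\<Union>x\<in>H. R x)" by (rule card_Un_le)
  also have "card (\<Union>x\<in>H. R x) \<le> (\<Sum>x\<in>H. card (R x))" by (rule card_UN_le[OF finH])
  finally have "q * card ({1..n} - core d lab) \<le> q * (card H + (\<Sum>x\<in>H. card (R x)))"
    by (intro mult_left_mono) auto
  also have "\<dots> = (\<Sum>x\<in>H. q) + (\<Sum>x\<in>H. q * card (R x))"
    by (simp add: distrib_left sum_distrib_left)
  also have "\<dots> \<le> (\<Sum>x\<in>H. deg lab x) + (\<Sum>x\<in>H. (k + 1) * 2 ^ k * deg lab x)"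
  proof (intro add_mono sum_mono)
    fix x assume x: "x \<in> H"
    then have "q ^ 1 \<le> q ^ (?L x - 1)" using q by (intro power_increasing) (auto simp: H_def)
    then show "q \<le> deg lab x" using Hle[OF x] by simp
  qed (rule cR)
  also have "\<dots> = (1 + (k + 1) * 2 ^ k) * (\<Sum>x\<in>H. deg lab x)"
    by (simp add: sum_distrib_left distrib_right sum.distrib)
  also have "\<dots> \<le> (1 + (k + 1) * 2 ^ k) * (2 * i)" by (intro mult_left_mono sumH) simp
  finally show ?thesis .
qed

section \<open>The small metric\<close>

text \<open>With \<open>f\<close> the distance to the core,
  \<open>min (d u v) (f u + f v + 1)\<close> is the distance after all core points are put at mutual
  distance 1. The answers survive because the levels bounding them are themselves bounded by
  \<open>f\<close> outside the core.\<close>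

lemma low_metric:
  assumes st: "state i d lab" and ne: "core d lab \<noteq> {}"
  obtains e where "\<And>u v. e u v = e v u" "\<And>u v. e u v = 0 \<longleftrightarrow> u = v"
    "\<And>u v w. e u w \<le> e u v + e v w" "\<And>u v. e u v \<le> d u v"
    "\<And>u v. lab u v > 0 \<Longrightarrow> e u v = d u v"
    "\<And>u v. u \<in> core d lab \<Longrightarrow> v \<in> core d lab \<Longrightarrow> lab u v = 0 \<Longrightarrow> e u v \<le> (1::nat)"
proof -
  note R = d_refl[OF st] and C = d_comm[OF st] and T = d_tri[OF st] and G = d_ge2[OF st]
  let ?M = "core d lab"
  let ?L = "\<lambda>x. lev (deg lab x)"
  define f where "f u = Min (d u ` ?M)" for u
  have finM: "finite ?M" by (simp add: core_def)
  have fle: "f u \<le> d u p" if "p \<in> ?M" for u p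
    unfolding f_def using finM that by (intro Min_le) auto
  have fex: "\<exists>p\<in>?M. f u = d u p" for u
  proof -
    have "f u \<in> d u ` ?M" unfolding f_def using finM ne by (intro Min_in) auto
    then show ?thesis by auto
  qed
  have fL: "f u \<le> d u v + f v" for u v
    using fex[of v] fle T by (metis order_trans)
  have fM: "f u = 0" if "u \<in> ?M" for u using fle[OF that, of u] R by simp
  have fN: "?L u \<le> f u" if "u \<in> {1..n}" "u \<notin> ?M" for u
  proof -
    obtain p where "p \<in> ?M" "f u = d u p" using fex by blast
    moreover have "u \<noteq> p" using that \<open>p \<in> ?M\<close> by blast
    ultimately show ?thesis using that(1) by (simp add: core_def)
  qed
  have Lcore: "?L u = 1" if "u \<in> ?M" for u using that by (simp add: core_def)
  have L1: "?L u \<ge> 1" for u by (rule lev_bounds)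
  \<comment> \<open>The root \<open>a\<close>, \<open>b\<close> has distance at most the sum of its
    levels. Unless both points lie in the core, this is at most \<open>f a + f b + 1\<close>: a core
    point has level 1 and \<open>f = 0\<close>, and any other has level at most \<open>f\<close>. As
    \<open>f\<close> is 1-Lipschitz, the bound carries over to \<open>x\<close>,
    \<open>y\<close>.\<close>
  have main: "d x y \<le> 2 \<or> d x y \<le> f x + f y + 1" if xy: "lab x y > 0" for x y
  proof -
    from root[OF st xy] obtain a b where ab: "lab a b > 0" "d x y + d a x + d b y \<le> d a b"
      "d a b \<le> ?L a + ?L b" by blast
    show ?thesis
    proof (cases "a \<in> ?M \<and> b \<in> ?M")
      case True
      then show ?thesis using ab Lcore by auto
    next
      case False
      have "?L a + ?L b \<le> f a + f b + 1"
        using False fN[OF lab_in(1)[OF st ab(1)]] fN[OF lab_in(2)[OF st ab(1)]] Lcore[of a] Lcore[of b]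
        by force
      then show ?thesis using ab fL[of a x] fL[of b y] by linarith
    qed
  qed
  \<comment> \<open>Queried pairs inside the core were answered with 2, so they are exempt from the gluing.\<close>
  define Q where "Q u v \<longleftrightarrow> u \<in> ?M \<and> v \<in> ?M \<and> lab u v > 0" for u v
  have Qs: "Q u v \<longleftrightarrow> Q v u" for u v using lab_sym[OF st] by (auto simp: Q_def)
  define e where "e u v = (if u = v then 0 else if Q u v then 2 else min (d u v) (f u + f v + 1))" for u v
  have Qd: "d u v = 2" if "Q u v" for u v
    using main[of u v] G[of u v] fM[of u] fM[of v] lab_neq[OF st, of u v] that unfolding Q_def by force
  have es: "e u v = e v u" for u v using C[of u v] Qs[of u v] by (simp add: e_def add.commute)
  have e1: "e u v \<ge> 1" if "u \<noteq> v" for u v using G[OF that] that by (auto simp: e_def)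
  have ed: "e u v \<le> d u v" for u v using Qd[of u v] R by (auto simp: e_def)
  have eq: "e u v = d u v" if uv: "lab u v > 0" for u v
  proof -
    have ne: "u \<noteq> v" using lab_neq[OF st uv] .
    show ?thesis
    proof (cases "Q u v")
      case True
      then show ?thesis using ne Qd by (simp add: e_def)
    next
      case False
      then have "u \<notin> ?M \<or> v \<notin> ?M" using uv by (auto simp: Q_def)
      \<comment> \<open>A point outside the core has \<open>f \<ge> 1\<close>, so the alternative
        \<open>d u v \<le> 2\<close> in \<open>main\<close> is absorbed.\<close>
      then have "f u + f v + 1 \<ge> 2"
        using fN[OF lab_in(1)[OF st uv]] fN[OF lab_in(2)[OF st uv]] L1[of u] L1[of v] by auto
      then have "d u v \<le> f u + f v + 1" using main[OF uv] by linarith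
      then show ?thesis using ne False by (simp add: e_def)
    qed
  qed
  \<comment> \<open>Exempt pairs have \<open>e = d\<close>, so on the right of the triangle
    inequality they need no separate case.\<close>
  have lower: "e u v \<ge> min (d u v) (f u + f v + 1)" for u v
    using R[of u] Qd[of u v] by (auto simp: e_def)
  have tri: "e u w \<le> e u v + e v w" for u v w
  proof -
    consider "u = w" | "u = v" | "v = w" | "u \<noteq> w" "u \<noteq> v" "v \<noteq> w" by blast
    then show ?thesis
    proof cases
      case 4
      show ?thesis
      proof (cases "Q u w")
        \<comment> \<open>An exempt distance is 2, and two nonzero distances always sum to at least
          2.\<close>
        case True
        then show ?thesis using e1[OF 4(2)] e1[OF 4(3)] 4 by (simp add: e_def)
      next
        case False
        then have le: "e u w \<le> d u w" "e u w \<le> f u + f w + 1" using 4 by (auto simp: e_def)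
        consider "e u v \<ge> d u v" "e v w \<ge> d v w" | "e u v \<ge> d u v" "e v w \<ge> f v + f w + 1"
          | "e u v \<ge> f u + f v + 1" "e v w \<ge> d v w" | "e u v \<ge> f u + f v + 1" "e v w \<ge> f v + f w + 1"
          using lower[of u v] lower[of v w] by linarith
        then show ?thesis
        proof cases
          case 1
          then show ?thesis using le T[of u w v] by linarith
        next
          case 2
          then show ?thesis using le fL[of u v] by linarith
        next
          case 3
          then show ?thesis using le fL[of w v] C[of w v] by linarith
        next
          case 4
          then show ?thesis using le by linarith
        qed
      qed
    qed (auto simp: e_def)
  qed
  have zero: "e u v = 0 \<longleftrightarrow> u = v" for u v using e1[of u v] by (auto simp: e_def)
  have one: "e u v \<le> 1" if "u \<in> ?M" "v \<in> ?M" "lab u v = 0" for u v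
    using that fM by (simp add: e_def Q_def)
  show ?thesis by (rule that[OF es zero tri ed eq one])
qed

section \<open>Playing against the algorithm and comparing the two averages\<close>

text \<open>The metric changes with every move, but answers already given persist. By
  \<open>run_eqI\<close> the run against the current metric is therefore also the run against the
  next one, and the adaptive game becomes a run against one fixed oracle.\<close>

lemma adversary_run:
  assumes alg: "\<forall>i\<in>{1..m}. query i \<in> transcripts n (i - 1) \<rightarrow> nsets {1..n} 2"
    and "i \<le> m"
  shows "\<exists>d lab. state i d lab \<and>
    (\<forall>e\<in>fst ` set (run query (pair_dist (\<lambda>u v. real (d u v)) (\<lambda>x. x)) i). \<exists>x y. e = {x, y} \<and> lab x y > 0)"
  using \<open>i \<le> m\<close>
proof (induction i)
  case 0
  show ?case using state_init by auto
next
  case (Suc i)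
  then obtain d lab where st: "state i d lab" and
    Q: "\<And>e. e \<in> fst ` set (run query (pair_dist (\<lambda>u v. real (d u v)) (\<lambda>x. x)) i) \<Longrightarrow>
      \<exists>x y. e = {x, y} \<and> lab x y > 0" by (meson Suc_leD)
  let ?D = "\<lambda>d. pair_dist (\<lambda>u v. real (d u v)) (\<lambda>x::nat. x)"
  define h where "h = run query (?D d) i"
  have "h \<in> transcripts n i"
    unfolding h_def using Suc.prems by (intro run_in_transcripts[OF alg]) (auto simp: pair_dist_def)
  then have "query (Suc i) h \<in> nsets {1..n} 2"
    using Suc.prems bspec[OF alg, of "Suc i"] by auto
  then obtain x y where e: "query (Suc i) h = {x, y}" and xy: "x \<in> {1..n}" "y \<in> {1..n}" "x \<noteq> y"
    by (auto simp: nsets_def card_2_iff)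
  from state_step[OF st xy] obtain d' lab' where st': "state (Suc i) d' lab'" and pos: "lab' x y > 0"
    and keep: "\<And>u v. lab u v > 0 \<Longrightarrow> lab' u v > 0 \<and> d' u v = d u v" by blast
  have "run query (?D d') i = h"
    unfolding h_def
  proof (rule run_eqI)
    fix e assume "e \<in> fst ` set (run query (?D d) i)"
    then obtain a b where ab: "e = {a, b}" "lab a b > 0" using Q by blast
    have "?D d' {a, b} = real (d' a b)" "?D d {a, b} = real (d a b)"
      using d_comm[OF st] d_comm[OF st'] by (auto intro!: pair_dist_doubleton)
    then show "?D d' e = ?D d e" using ab keep by simp
  qed
  then have "fst ` set (run query (?D d') (Suc i)) = insert {x, y} (fst ` set h)"
    by (simp add: Let_def e)
  then have "\<forall>e\<in>fst ` set (run query (?D d') (Suc i)). \<exists>u v. e = {u, v} \<and> lab' u v > 0"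
    using pos Q[folded h_def] keep by (metis insertE)
  then show ?case using st' by (intro exI[of _ d'] exI[of _ lab'] conjI)
qed

text \<open>\<open>d\<close> and the small metric \<open>e\<close> produce the same transcript,
  hence the same estimate, so the average of \<open>d\<close> is at most \<open>\<alpha>\<close>
  times that of \<open>e\<close>. Both averages are scaled by \<open>n ^ 2\<close>; \<open>b\<close>
  is the number of points outside the core.\<close>

lemma approx_algorithm_bound:
  assumes alg: "approx_algorithm n m \<alpha> query estimate" and n: "n \<ge> 1" and \<alpha>: "\<alpha> \<ge> 0"
  shows "\<exists>b. q * b \<le> (1 + (k + 1) * 2 ^ k) * (2 * m) \<and>
    (2 * k + 2) * (real n ^ 2 - 2 * (n * ((k + 1) * (2 * q) ^ k))) \<le>
    \<alpha> * (real n ^ 2 + (2 * k + 2) * (2 * n * b + 2 * m))"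
proof -
  have qs: "\<forall>i\<in>{1..m}. query i \<in> transcripts n (i - 1) \<rightarrow> nsets {1..n} 2"
    using alg by (simp add: approx_algorithm_def)
  from adversary_run[OF qs order_refl] obtain d lab where st: "state m d lab" and
    Q: "\<And>e. e \<in> fst ` set (run query (pair_dist (\<lambda>u v. real (d u v)) (\<lambda>x. x)) m) \<Longrightarrow>
      \<exists>x y. e = {x, y} \<and> lab x y > 0" by meson
  define b where "b = card ({1..n} - core d lab)"
  define c where "c = 2 * k + 2"
  let ?V = "{1..n} \<times> {1..n}"
  have d0: "d u v = 0 \<longleftrightarrow> u = v" for u v using d_refl[OF st] d_ge2[OF st, of u v] by force
  obtain e where es: "\<And>u v. e u v = e v u" and e0: "\<And>u v. e u v = 0 \<longleftrightarrow> u = v"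
    and et: "\<And>u v w. e u w \<le> e u v + e v w" and ele: "\<And>u v. e u v \<le> d u v"
    and eq: "\<And>u v. lab u v > 0 \<Longrightarrow> e u v = d u v"
    and e1: "\<And>u v. u \<in> core d lab \<Longrightarrow> v \<in> core d lab \<Longrightarrow> lab u v = 0 \<Longrightarrow> e u v \<le> (1::nat)"
  \<comment> \<open>There is no distance to an empty core. In that case \<open>e = d\<close> will
    do, since every pair then counts as lost.\<close>
  proof (cases "core d lab = {}")
    case True
    show ?thesis
      by (rule that[of d]) (rule d_comm[OF st] d_tri[OF st] d0 order_refl HOL.refl | simp add: True)+
  next
    case False
    show ?thesis by (rule low_metric[OF st False]) (rule that)
  qed
  let ?a = "\<lambda>d. avg_dist n (\<lambda>u v. real (d u v)) (\<lambda>x. x)"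
  let ?E = "\<lambda>d. estimate (run query (pair_dist (\<lambda>u v. real (d u v)) (\<lambda>x. x)) m)"
  have bounds: "?a d \<le> ?E d \<and> ?E d \<le> \<alpha> * ?a d"
    if "\<And>u v. d u v = d v u" "\<And>u v. d u v = 0 \<longleftrightarrow> u = v" "\<And>u v w. d u w \<le> d u v + d v w"
    for d :: "nat \<Rightarrow> nat \<Rightarrow> nat"
  proof -
    have "Metric_space {1..n} (\<lambda>u v. real (d u v))"
    proof
      fix x y z
      show "real (d x y) = real (d y x)" by (simp add: that(1)[of x y])
      show "real (d x z) \<le> real (d x y) + real (d y z)" using that(3)[of x z y] by linarith
    qed (simp_all add: that(2))
    then have "approximates n m \<alpha> query estimate (\<lambda>u v. real (d u v)) (\<lambda>x. x)"
      by (rule approx_algorithm_all_metric_spaces[OF alg]) simp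
    then show ?thesis by (simp add: approximates_def Let_def)
  qed
  have "run query (pair_dist (\<lambda>u v. real (e u v)) (\<lambda>x. x)) m = run query (pair_dist (\<lambda>u v. real (d u v)) (\<lambda>x. x)) m"
  proof (rule run_eqI)
    fix p assume "p \<in> fst ` set (run query (pair_dist (\<lambda>u v. real (d u v)) (\<lambda>x. x)) m)"
    then obtain x y where xy: "p = {x, y}" "lab x y > 0" using Q by blast
    have "pair_dist (\<lambda>u v. real (d u v)) (\<lambda>x. x) {x, y} = d x y"
      "pair_dist (\<lambda>u v. real (e u v)) (\<lambda>x. x) {x, y} = e x y"
      using d_comm[OF st] es by (auto intro!: pair_dist_doubleton)
    then show "pair_dist (\<lambda>u v. real (e u v)) (\<lambda>x. x) p = pair_dist (\<lambda>u v. real (d u v)) (\<lambda>x. x) p"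
      using xy eq by simp
  qed
  moreover have "?a d \<le> ?E d" using bounds[of d, OF d_comm[OF st] d0 d_tri[OF st]] by blast
  moreover have "?E e \<le> \<alpha> * ?a e" using bounds[of e, OF es e0 et] by blast
  ultimately have "?a d \<le> \<alpha> * ?a e" by simp
  then have "real n ^ 2 * ?a d \<le> real n ^ 2 * (\<alpha> * ?a e)" by (intro mult_left_mono) auto
  moreover have avg: "real n ^ 2 * ?a d = real (\<Sum>(u, v)\<in>?V. d u v)" for d
    using n by (simp add: avg_dist_def case_prod_beta)
  ultimately have 1: "real (\<Sum>(u, v)\<in>?V. d u v) \<le> \<alpha> * real (\<Sum>(u, v)\<in>?V. e u v)"
    by (metis mult.left_commute)
  have lo: "(\<Sum>(u, v)\<in>?V. e u v) \<le> n ^ 2 + c * (2 * n * b + 2 * m)"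
  proof -
    let ?N = "{1..n} - core d lab"
    \<comment> \<open>A pair is charged 1, plus the maximal distance \<open>c\<close> for each of
      its defects: first point outside the core, second point outside the core, or queried.\<close>
    have "(\<Sum>(u, v)\<in>?V. e u v) \<le> (\<Sum>p\<in>?V. 1 + c * (of_bool (p \<in> ?N \<times> {1..n}) +
        of_bool (p \<in> {1..n} \<times> ?N) + of_bool (p \<in> {(x, y). lab x y > 0})))"
    proof (intro sum_mono, safe)
      fix u v assume uv: "u \<in> {1..n}" "v \<in> {1..n}"
      have "e u v \<le> c" using ele d_le[OF st] unfolding c_def by (rule order_trans)
      then show "e u v \<le> 1 + c * (of_bool ((u, v) \<in> ?N \<times> {1..n}) +
        of_bool ((u, v) \<in> {1..n} \<times> ?N) + of_bool ((u, v) \<in> {(x, y). lab x y > 0}))"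
        using uv e1[of u v] by (cases "u \<in> core d lab"; cases "v \<in> core d lab"; cases "lab u v = 0") auto
    qed
    also have "\<dots> = card ?V + c * (card (?V \<inter> (?N \<times> {1..n})) + card (?V \<inter> ({1..n} \<times> ?N)) +
        card (?V \<inter> {(x, y). lab x y > 0}))"
      by (simp only: sum.distrib sum_distrib_left[symmetric] sum_of_bool_eq finite_cartesian_product
          finite_atLeastAtMost sum_constant Int_def) (simp add: Int_def)
    also have "\<dots> \<le> n ^ 2 + c * (b * n + n * b + 2 * m)"
    proof (intro add_mono mult_left_mono)
      have "?V \<inter> (?N \<times> {1..n}) = ?N \<times> {1..n}" "?V \<inter> ({1..n} \<times> ?N) = {1..n} \<times> ?N" by auto
      then show "card (?V \<inter> (?N \<times> {1..n})) \<le> b * n" "card (?V \<inter> ({1..n} \<times> ?N)) \<le> n * b"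
        by (simp_all add: b_def card_cartesian_product)
      have "card (?V \<inter> {(x, y). lab x y > 0}) \<le> card {(x, y). lab x y > 0}"
        using finite_lab_pairs[OF st] by (intro card_mono) auto
      then show "card (?V \<inter> {(x, y). lab x y > 0}) \<le> 2 * m" using card_lab[OF st] by simp
    qed (auto simp: power2_eq_square)
    finally show ?thesis by (simp add: algebra_simps)
  qed
  have hi: "n ^ 2 * c \<le> (\<Sum>(u, v)\<in>?V. d u v) + c * (2 * (n * ((k + 1) * (2 * q) ^ k)))"
  proof -
    let ?B = "{(u, v) \<in> ?V. d u v < 2 * k + 2}"
    have "n ^ 2 * c = (\<Sum>p\<in>?V. c)" by (simp add: power2_eq_square)
    also have "\<dots> \<le> (\<Sum>p\<in>?V. (case p of (u, v) \<Rightarrow> d u v) + c * of_bool (p \<in> ?B))"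
      by (intro sum_mono) (auto simp: c_def)
    also have "\<dots> = (\<Sum>(u, v)\<in>?V. d u v) + c * card (?V \<inter> ?B)"
      by (simp only: sum.distrib sum_distrib_left[symmetric] sum_of_bool_eq finite_cartesian_product
          finite_atLeastAtMost) (simp add: Int_def)
    also have "?V \<inter> ?B = ?B" by auto
    also have "(\<Sum>(u, v)\<in>?V. d u v) + c * card ?B \<le> (\<Sum>(u, v)\<in>?V. d u v) + c * (2 * (n * ((k + 1) * (2 * q) ^ k)))"
      by (intro add_left_mono mult_left_mono card_near[OF st]) simp
    finally show ?thesis .
  qed
  have "real c * (real n ^ 2 - 2 * (n * ((k + 1) * (2 * q) ^ k))) \<le> real (\<Sum>(u, v)\<in>?V. d u v)"
    using of_nat_mono[OF hi, where 'a = real] by (simp add: algebra_simps)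
  also note 1
  also have "\<alpha> * real (\<Sum>(u, v)\<in>?V. e u v) \<le> \<alpha> * (real n ^ 2 + c * (2 * n * b + 2 * m))"
    using of_nat_mono[OF lo, where 'a = real] \<alpha> by (intro mult_left_mono) (simp_all add: algebra_simps)
  finally show ?thesis
    using card_not_core[OF st] unfolding b_def c_def by blast
qed

end

section \<open>Choice of \<open>q\<close> and passage to the limit\<close>

theorem theorem1p24:
  fixes k :: nat and \<alpha> :: real and m :: "nat \<Rightarrow> nat"
  assumes "k \<ge> 1" and "\<alpha> \<ge> 1"
    and "\<forall>n\<ge>1. \<exists>query estimate. approx_algorithm n (m n) \<alpha> query estimate"
    and "(\<lambda>n. real (m n)) \<in> o(\<lambda>n. real n powr ((real k + 1) / real k))"
  shows "\<alpha> \<ge> 2 * (real k + 1)"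
proof -
  define c :: real where "c = 2 * k + 2"
  define C :: real where "C = 1 + (real k + 1) * 2 ^ k"
  define r where "r n = real (m n) / real n powr ((real k + 1) / real k)" for n
  have c0: "c \<ge> 0" by (simp add: c_def)
  have r0: "r \<longlonglongrightarrow> 0" unfolding r_def using assms(4) by (rule smalloD_tendsto)
  \<comment> \<open>For fixed \<open>\<delta>\<close>, the near pairs are a fraction of order
    \<open>\<delta> ^ k\<close>, while the points outside the core and the queried pairs vanish in
    proportion as \<open>n\<close> grows. Only afterwards does \<open>\<delta>\<close> tend to
    0.\<close>
  have "c * (1 - 2 * (real k + 1) * (4 * \<delta>) ^ k) \<le> \<alpha>" if \<delta>: "\<delta> > 0" for \<delta> :: real
  proof -
    have "filterlim (\<lambda>n. \<delta> * real n powr (1 / real k)) at_top sequentially"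
      using \<delta> assms(1) by real_asymp
    then have ev: "\<forall>\<^sub>F n in sequentially. \<delta> * real n powr (1 / real k) \<ge> 1"
      by (simp add: filterlim_at_top)
    have "\<forall>\<^sub>F n in sequentially. c * (1 - 2 * (real k + 1) * (4 * \<delta>) ^ k) \<le>
        \<alpha> * (1 + c * (4 * C / \<delta> + 2) * r n)"
      using ev eventually_ge_at_top[of 1]
    proof eventually_elim
      case (elim n)
      define N where "N = real n"
      have N: "N \<ge> 1" using elim by (simp add: N_def)
      define s where "s = N powr (1 / real k)"
      have s: "s > 0" "\<delta> * s \<ge> 1" and sk: "s ^ k = N"
        using N assms(1) elim unfolding s_def N_def by (auto simp: powr_realpow[symmetric] powr_powr)
      have Ns: "N powr ((real k + 1) / real k) = N * s"
        using N assms(1) by (simp add: s_def add_divide_distrib powr_add)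
      have mr: "real (m n) = r n * (N * s)" using N s by (simp add: r_def N_def[symmetric] Ns)
      have rn: "r n \<ge> 0" by (simp add: r_def)
      \<comment> \<open>This makes the number of queries at most \<open>r n * N ^ 2\<close>,
        negligible among all pairs.\<close>
      have "s \<le> N powr 1" unfolding s_def using N assms(1) by (intro powr_mono) auto
      then have sN: "s \<le> N" using N by simp
      \<comment> \<open>Since \<open>\<delta> * s \<ge> 1\<close>, rounding up at most doubles,
        which is the origin of \<open>4 * \<delta>\<close> as a bound on
        \<open>2 * q / s\<close>.\<close>
      define q where "q = nat \<lceil>\<delta> * s\<rceil>"
      have q1: "real q \<ge> \<delta> * s" and q2: "real q \<le> 2 * (\<delta> * s)" using s unfolding q_def by linarith+
      then have "q \<ge> 1" using s by linarith
      then interpret adversary n k q by unfold_locales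
      from assms(3) elim obtain query estimate where "approx_algorithm n (m n) \<alpha> query estimate" by blast
      from approx_algorithm_bound[OF this] elim assms(2) obtain b where
        qb: "q * b \<le> (1 + (k + 1) * 2 ^ k) * (2 * m n)" and
        main: "c * (N ^ 2 - 2 * (N * ((real k + 1) * (2 * real q) ^ k))) \<le>
          \<alpha> * (N ^ 2 + c * (2 * N * b + 2 * m n))"
        unfolding c_def N_def by (auto simp: algebra_simps)
      have "(2 * real q) ^ k \<le> (4 * \<delta> * s) ^ k" using q2 by (intro power_mono) auto
      also have "\<dots> = (4 * \<delta>) ^ k * N" by (simp add: power_mult_distrib sk)
      finally have "N * ((real k + 1) * (2 * real q) ^ k) \<le> N * ((real k + 1) * ((4 * \<delta>) ^ k * N))"
        using N by (intro mult_left_mono) auto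
      then have "c * (N ^ 2 * (1 - 2 * (real k + 1) * (4 * \<delta>) ^ k)) \<le>
          c * (N ^ 2 - 2 * (N * ((real k + 1) * (2 * real q) ^ k)))"
        using c0 by (intro mult_left_mono) (auto simp: algebra_simps power2_eq_square)
      also note main
      also have "\<alpha> * (N ^ 2 + c * (2 * N * b + 2 * m n)) \<le> \<alpha> * (N ^ 2 * (1 + c * (4 * C / \<delta> + 2) * r n))"
      proof -
        \<comment> \<open>Dividing the bound on \<open>q * b\<close> by \<open>\<delta> * s\<close>
          cancels the factor \<open>s\<close> in \<open>m n = r n * (N * s)\<close>, so
          \<open>b\<close> is of order \<open>r n * N\<close>.\<close>
        have "\<delta> * s * b \<le> real q * b" using q1 by (intro mult_right_mono) auto
        also have "\<dots> \<le> C * (2 * real (m n))"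
          using of_nat_mono[OF qb, where 'a = real] by (simp add: C_def algebra_simps)
        also have "\<dots> = s * (2 * C * r n * N)" by (simp add: mr)
        finally have "s * (\<delta> * b) \<le> s * (2 * C * r n * N)" by (simp add: mult.assoc mult.left_commute)
        then have "\<delta> * b \<le> 2 * C * r n * N" using s by simp
        then have "b \<le> 2 * C / \<delta> * r n * N" using \<delta> by (simp add: field_simps)
        then have "2 * N * b \<le> 2 * N * (2 * C / \<delta> * r n * N)" using N by (intro mult_left_mono) auto
        moreover have "2 * real (m n) \<le> 2 * (r n * (N * N))"
          unfolding mr using rn N sN by (intro mult_left_mono) auto
        ultimately have "2 * N * b + 2 * m n \<le> N ^ 2 * ((4 * C / \<delta> + 2) * r n)"
          by (simp add: algebra_simps power2_eq_square)
        then have "c * (2 * N * b + 2 * m n) \<le> c * (N ^ 2 * ((4 * C / \<delta> + 2) * r n))"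
          using c0 by (intro mult_left_mono)
        then show ?thesis using assms(2) by (intro mult_left_mono) (auto simp: algebra_simps)
      qed
      finally have "N ^ 2 * (c * (1 - 2 * (real k + 1) * (4 * \<delta>) ^ k)) \<le>
          N ^ 2 * (\<alpha> * (1 + c * (4 * C / \<delta> + 2) * r n))"
        by (simp add: mult.left_commute)
      then show ?case using N by (simp add: mult_le_cancel_left)
    qed
    moreover have "(\<lambda>n. \<alpha> * (1 + c * (4 * C / \<delta> + 2) * r n)) \<longlonglongrightarrow> \<alpha> * (1 + c * (4 * C / \<delta> + 2) * 0)"
      by (intro tendsto_intros r0)
    ultimately show ?thesis by (intro tendsto_lowerbound) auto
  qed
  \<comment> \<open>As \<open>k \<ge> 1\<close>, the error term \<open>(4 * \<delta>) ^ k\<close>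
    vanishes in the limit from the right.\<close>
  then have "\<forall>\<^sub>F \<delta> in at_right 0. c * (1 - 2 * (real k + 1) * (4 * \<delta>) ^ k) \<le> \<alpha>"
    by (auto simp: eventually_at_filter)
  moreover have "((\<lambda>\<delta>. c * (1 - 2 * (real k + 1) * (4 * \<delta>) ^ k)) \<longlongrightarrow>
      c * (1 - 2 * (real k + 1) * (4 * 0) ^ k)) (at_right (0::real))"
    by (intro tendsto_intros)
  ultimately have "c * (1 - 2 * (real k + 1) * (4 * 0) ^ k) \<le> \<alpha>"
    by (intro tendsto_upperbound) auto
  then show ?thesis using assms(1) by (simp add: c_def power_0_left)
qed

end
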